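(* Let $n,r_1,r_2\ge0$ be integers with $r_1\ge r_2+n+1$. Let $P\in\mathbb{Q}[k_1,k_2]$ have degree at most $3n+1$ with respect to each variable, and satisfy $$P(k_2+r_2-r_1,\;k_1+r_1-r_2)=-P(k_1,k_2).$$ Then the series $$\sum_{k_1\ge k_2\ge1}\frac{P(k_1,k_2)}{(k_1+r_1)_{n+1}^3(k_2+r_2)_{n+1}^3}$$ is a linear combination with rational coefficients of $1$, $\zeta(2)$, $\zeta(3)$ and $\zeta(2,3)-\zeta(3,2)$.
   Context: $(k)_\alpha=k(k+1)\cdots(k+\alpha-1)$ is the Pochhammer symbol. Multiple zeta values: $\zeta(s_1,\dots,s_q)=\sum_{k_1>\dots>k_q\ge1}k_1^{-s_1}\cdots k_q^{-s_q}$ for $s_1\ge2$, $s_i\ge1$. *)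

theory Defs
  imports "HOL-Analysis.Analysis" "HOL-Computational_Algebra.Polynomial"
begin

text \<open>
  A polynomial in \<open>R[k1,k2]\<close> is represented as an element of \<open>R[k1][k2]\<close>, that is, of type
  \<open>'a poly poly\<close>: the outer variable is \<open>k2\<close>, and the coefficients are polynomials in \<open>k1\<close>.
\<close>

definition var1 :: "'a::comm_ring_1 poly poly" where
  "var1 = [:[:0, 1:]:]"

definition var2 :: "'a::comm_ring_1 poly poly" where
  "var2 = [:0, 1:]"

definition degree1_le :: "'a::zero poly poly \<Rightarrow> nat \<Rightarrow> bool" where
  "degree1_le P d \<longleftrightarrow> (\<forall>i. degree (coeff P i) \<le> d)"

definition degree2_le :: "'a::zero poly poly \<Rightarrow> nat \<Rightarrow> bool" where
  "degree2_le P d \<longleftrightarrow> degree P \<le> d"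

text \<open>
  The value \<open>P(x, y)\<close> in a commutative ring into which the coefficients are mapped by \<open>h\<close>,
  where \<open>x\<close> is substituted for \<open>k1\<close> and \<open>y\<close> for \<open>k2\<close>.
\<close>

definition eval2 ::
    "('a::zero \<Rightarrow> 'b::comm_ring_1) \<Rightarrow> 'a poly poly \<Rightarrow> 'b \<Rightarrow> 'b \<Rightarrow> 'b" where
  "eval2 h P x y = poly (map_poly (\<lambda>c. poly (map_poly h c) x) P) y"

definition subst2 ::
    "'a::comm_ring_1 poly poly \<Rightarrow> 'a poly poly \<Rightarrow> 'a poly poly \<Rightarrow> 'a poly poly" where
  "subst2 P A B = eval2 (\<lambda>c. [:[:c:]:]) P A B"

text \<open>
  The index \<open>[s1, ..., sq]\<close> belongs to the first (largest) summation variable first, so that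
  \<open>mzv [s1, s2]\<close> is the sum of \<open>1 / (k1 ^ s1 * k2 ^ s2)\<close> over \<open>k1 > k2 \<ge> 1\<close>. It is the
  multiple zeta value only if \<open>s1 \<ge> 2\<close> and all \<open>si \<ge> 1\<close>; \<open>infsum\<close> is 0 for a divergent series.
\<close>

definition mzv :: "nat list \<Rightarrow> real" where
  "mzv s = (\<Sum>\<^sub>\<infinity>k\<in>{k :: nat list. length k = length s \<and> sorted_wrt (>) k \<and> (\<forall>m\<in>set k. m \<ge> 1)}.
     \<Prod>i<length s. 1 / real (k ! i) ^ (s ! i))"

end

theory Submission
  imports Defs "HOL-Computational_Algebra.Polynomial_Factorial"
    "HOL-Computational_Algebra.Field_as_Ring"
begin

text \<open>
  Put \<open>x = k1 + r1\<close> and \<open>y = k2 + r2\<close>. The symmetry of \<open>P\<close> makes the summand antisymmetric in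
  \<open>x, y\<close>, so it is a sum of terms \<open>c (i, s) (j, t) / ((x + i) ^ s * (y + j) ^ t)\<close> with antisymmetric
  rational coefficients; the degree bound makes the residues in \<open>x\<close> (the sums over \<open>i\<close> for
  \<open>s = 1\<close>) vanish. Summing over \<open>x\<close> yields regularised zeta tails started beyond \<open>y + j\<close>, because
  \<open>r1 \<ge> r2 + n + 1\<close>. Moving the start to \<open>y + j\<close> costs series
  \<open>\<Sum> 1 / (v ^ t * (v + l) ^ s)\<close> with \<open>l \<ge> 1\<close>, which are rational combinations of 1, zeta(2) and
  zeta(3). What remains is \<open>\<Sum> C s t * zeta(s, t)\<close> with \<open>C\<close> antisymmetric and \<open>C 1 t = 0\<close>, that is,
  \<open>C 2 3 * (zeta(2, 3) - zeta(3, 2))\<close>.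
\<close>

section \<open>Partial fractions\<close>

text \<open>Only one term of the convolution survives. Degree bounds instead of exact degrees allow
  the tracked coefficients to be 0.\<close>

lemma coeff_mult_top:
  fixes p q :: "'a::comm_semiring_0 poly"
  assumes "degree p \<le> i" "degree q \<le> j"
  shows "coeff (p * q) (i + j) = coeff p i * coeff q j"
proof -
  have "coeff p k * coeff q (i + j - k) = 0" if "k \<noteq> i" for k
    using that assms by (cases "k < i") (auto simp: coeff_eq_0)
  then have "coeff (p * q) (i + j) = (\<Sum>k\<in>{i}. coeff p k * coeff q (i + j - k))"
    unfolding coeff_mult by (intro sum.mono_neutral_right) auto
  then show ?thesis by simp
qed

lemma poly_eq_sum_le:
  fixes p :: "'a::comm_semiring_1 poly"
  assumes "degree p \<le> d"
  shows "poly p x = (\<Sum>i\<le>d. coeff p i * x ^ i)"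
  unfolding poly_altdef using assms
  by (intro sum.mono_neutral_left) (auto simp: coeff_eq_0)

lemma coprime_linear_polys:
  fixes a b :: "'a::field_gcd"
  assumes "a \<noteq> b"
  shows "coprime [:a, 1:] [:b, 1:]"
proof (rule coprimeI)
  fix c assume "c dvd [:a, 1:]" "c dvd [:b, 1:]"
  then have "c dvd [:a, 1:] - [:b, 1:]" by (rule dvd_diff)
  then have "c dvd [:a - b:]" by simp
  moreover have "is_unit [:a - b:]" using assms by (simp add: is_unit_const_poly_iff dvd_field_iff)
  ultimately show "is_unit c" by (rule dvd_trans)
qed

text \<open>A pair \<open>(i, s)\<close> stands for the partial fraction \<open>1 / (x + i) ^ s\<close>.\<close>

definition idx :: "nat \<Rightarrow> (nat \<times> nat) set" where
  "idx n = {..n} \<times> {1..3}"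

lemma finite_idx [simp]: "finite (idx n)"
  by (simp add: idx_def)

lemma sum_idx: "(\<Sum>p\<in>idx n. f p) = (\<Sum>i\<le>n. \<Sum>s\<in>{1..3}. f (i, s))"
  unfolding idx_def by (simp add: sum.cartesian_product)

text \<open>The cubed Pochhammer symbol as a polynomial. The argument counts the factors, so the
  denominator in the series corresponds to \<open>pden (Suc n)\<close>.\<close>

definition pden :: "nat \<Rightarrow> rat poly" where
  "pden n = (\<Prod>i<n. [:of_nat i, 1:] ^ 3)"

lemma poly_pden: "poly (pden n) x = pochhammer x n ^ 3"
  by (simp add: pden_def poly_prod pochhammer_prod prod_power_distrib lessThan_atLeast0 add.commute)

lemma pden_Suc: "pden (Suc n) = pden n * [:of_nat n, 1:] ^ 3"
  by (simp add: pden_def)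

lemma pden_nz: "pden n \<noteq> 0"
  by (auto simp: pden_def)

lemma degree_pden: "degree (pden n) = 3 * n"
proof (induction n)
  case 0 then show ?case by (simp add: pden_def)
next
  case (Suc n)
  have "degree (pden (Suc n)) = degree (pden n) + degree ([:of_nat n, 1:: rat:] ^ 3)"
    unfolding pden_Suc by (rule degree_mult_eq) (auto simp: pden_nz)
  with Suc show ?case by (simp add: degree_linear_power)
qed

lemma lead_coeff_pden: "lead_coeff (pden n) = 1"
  by (induction n) (simp_all add: pden_def lead_coeff_mult lead_coeff_power)

text \<open>Taylor expansion of \<open>u\<close> at \<open>- b\<close>. The coefficient of
  \<open>(x + b) ^ 2\<close> is the top coefficient of \<open>u\<close> and becomes the residue
  \<open>a 1\<close>.\<close>

lemma quadratic_partial_fractions: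
  fixes u :: "rat poly"
  assumes "degree u \<le> 2"
  shows "\<exists>a::nat \<Rightarrow> rat. a 1 = coeff u 2 \<and>
    (\<forall>x. x + b \<noteq> 0 \<longrightarrow> poly u x / (x + b) ^ 3 = (\<Sum>s\<in>{1..3}. a s / (x + b) ^ s))"
proof -
  define c0 c1 c2 where "c0 = coeff u 0" and "c1 = coeff u 1" and "c2 = coeff u 2"
  have u: "poly u x = c0 + c1 * x + c2 * x ^ 2" for x
  proof -
    have "poly u x = (\<Sum>i\<le>2. coeff u i * x ^ i)"
      by (rule poly_eq_sum_le) (use assms in auto)
    then show ?thesis by (simp add: c0_def c1_def c2_def numeral_2_eq_2 atMost_Suc)
  qed
  \<comment> \<open>The Taylor coefficients of \<open>u\<close> at \<open>- b\<close>: half the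
    second derivative, the first derivative and the value.\<close>
  define a where "a = (\<lambda>s::nat. if s = 1 then c2 else if s = 2 then c1 - 2 * c2 * b
                                 else c0 - c1 * b + c2 * b ^ 2)"
  have s3: "{1..3} = {1, 2, 3 :: nat}" by auto
  have "poly u x / (x + b) ^ 3 = (\<Sum>s\<in>{1..3}. a s / (x + b) ^ s)" if "x + b \<noteq> 0" for x
  proof -
    define z where "z = x + b"
    have x: "x = z - b" by (simp add: z_def)
    show ?thesis using that unfolding s3 u a_def z_def[symmetric] unfolding x
      by (simp add: field_simps power2_eq_square power3_eq_cube)
  qed
  then show ?thesis by (intro exI[of _ a]) (auto simp: a_def c2_def)
qed

text \<open>Induction on the number of poles; the last one is split off by a Bezout identity. The
  residue sum is carried along: it is the limit of \<open>x\<close> times the fraction at infinity,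
  hence the top coefficient of \<open>p\<close> over a monic denominator.\<close>

lemma partial_fractions_aux:
  fixes p :: "rat poly"
  assumes "degree p \<le> 3 * n + 2"
  shows "\<exists>A::nat \<Rightarrow> nat \<Rightarrow> rat. (\<Sum>i\<le>n. A i 1) = coeff p (3 * n + 2) \<and>
    (\<forall>x>0. poly p x / poly (pden (Suc n)) x = (\<Sum>i\<le>n. \<Sum>s\<in>{1..3}. A i s / (x + of_nat i) ^ s))"
  using assms
proof (induction n arbitrary: p)
  case 0
  then obtain a :: "nat \<Rightarrow> rat" where a: "a 1 = coeff p 2"
    "\<And>x. x + 0 \<noteq> 0 \<Longrightarrow> poly p x / (x + 0) ^ 3 = (\<Sum>s\<in>{1..3}. a s / (x + 0) ^ s)"
    using quadratic_partial_fractions[of p 0] by auto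
  show ?case
    by (rule exI[of _ "\<lambda>_. a"]) (use a in \<open>auto simp: pden_def numeral_2_eq_2\<close>)
next
  case (Suc n)
  define D where "D = pden (Suc n)"
  define E :: "rat poly" where "E = [:of_nat (Suc n), 1:] ^ 3"
  have degD: "degree D = 3 * n + 3" by (simp add: D_def degree_pden)
  have degE: "degree E = 3" unfolding E_def by (simp add: degree_linear_power)
  have "coprime D E"
    unfolding D_def E_def pden_def
  proof (rule prod_coprime_left)
    fix i assume "i \<in> {..<Suc n}"
    then have "of_nat i \<noteq> (of_nat (Suc n) :: rat)" by (simp only: of_nat_eq_iff) simp
    then show "coprime ([:of_nat i, 1::rat:] ^ 3) ([:of_nat (Suc n), 1:] ^ 3)"
      by (intro coprime_power_left_iff[THEN iffD2] coprime_power_right_iff[THEN iffD2] disjI1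
            coprime_linear_polys)
  qed
  then have "fst (bezout_coefficients D E) * D + snd (bezout_coefficients D E) * E = 1"
    unfolding bezout_coefficients_fst_snd by (rule coprime_imp_gcd_eq_1)
  then obtain r s where rs: "r * D + s * E = 1" by blast
  \<comment> \<open>Multiplying the Bezout identity by \<open>p\<close> gives numerators over
    \<open>E\<close> and \<open>D\<close>. Reducing the first modulo \<open>E\<close> makes it
    quadratic; the quotient moves into \<open>w\<close>.\<close>
  define u where "u = (p * r) mod E"
  define w where "w = p * s + ((p * r) div E) * D"
  have p: "p = u * D + w * E"
  proof -
    have "p = p * (r * D + s * E)" by (simp add: rs)
    also have "\<dots> = (p * r) * D + p * s * E" by (simp add: algebra_simps)
    also have "p * r = (p * r) div E * E + u" by (simp add: u_def)
    finally show ?thesis by (simp add: w_def algebra_simps)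
  qed
  have degu: "degree u \<le> 2"
    using degree_mod_less[of E "p * r"] degE unfolding u_def by (cases "E = 0") auto
  \<comment> \<open>The degree of \<open>w\<close> cannot be read off its definition, but
    \<open>w * E = p - u * D\<close> bounds it, since \<open>E\<close> has degree 3.\<close>
  have "degree (w * E) \<le> 3 * n + 5"
  proof -
    have "w * E = p - u * D" using p by simp
    moreover have "degree (u * D) \<le> 3 * n + 5"
      using degree_mult_le[of u D] degu degD by simp
    ultimately show ?thesis using Suc.prems by (simp add: degree_diff_le)
  qed
  then have degw: "degree w \<le> 3 * n + 2"
    using degree_mult_eq[of w E] degE by (cases "w = 0"; cases "E = 0") auto
  from Suc.IH[OF degw] obtain A where A: "(\<Sum>i\<le>n. A i 1) = coeff w (3 * n + 2)"
    "\<And>x. x > 0 \<Longrightarrow> poly w x / poly D x = (\<Sum>i\<le>n. \<Sum>s\<in>{1..3}. A i s / (x + of_nat i) ^ s)"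
    unfolding D_def by auto
  obtain a :: "nat \<Rightarrow> rat" where a: "a 1 = coeff u 2"
    "\<And>x. x + of_nat (Suc n) \<noteq> 0 \<Longrightarrow>
       poly u x / (x + of_nat (Suc n)) ^ 3 = (\<Sum>s\<in>{1..3}. a s / (x + of_nat (Suc n)) ^ s)"
    using quadratic_partial_fractions[OF degu, of "of_nat (Suc n)"] by auto
  define A' where "A' = (\<lambda>i. if i = Suc n then a else A i)"
  have A': "(\<Sum>i\<le>Suc n. f i (A' i)) = (\<Sum>i\<le>n. f i (A i)) + f (Suc n) a"
    for f :: "nat \<Rightarrow> (nat \<Rightarrow> rat) \<Rightarrow> rat"
    by (simp add: A'_def)
  \<comment> \<open>As \<open>D\<close> and \<open>E\<close> are monic, the top coefficients of
    \<open>u\<close> and \<open>w\<close> add up to that of \<open>p\<close>, just as the residues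
    do.\<close>
  have "coeff p (3 * Suc n + 2) = coeff (u * D) (2 + (3 * n + 3)) + coeff (w * E) ((3 * n + 2) + 3)"
    by (subst p) (simp add: add.commute numeral_eq_Suc)
  also have "\<dots> = coeff u 2 * coeff D (3 * n + 3) + coeff w (3 * n + 2) * coeff E 3"
    using degu degD degw degE by (subst (1 2) coeff_mult_top) auto
  also have "coeff D (3 * n + 3) = 1" using lead_coeff_pden[of "Suc n"] degD by (simp add: D_def)
  also have "coeff E 3 = 1" using degE lead_coeff_power[of "[:of_nat (Suc n), 1::rat:]" 3]
    by (simp add: E_def del: of_nat_Suc)
  finally have 1: "(\<Sum>i\<le>Suc n. A' i 1) = coeff p (3 * Suc n + 2)"
    using A'[of "\<lambda>_ f. f 1"] A(1) a(1) by simp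
  have 2: "poly p x / poly (pden (Suc (Suc n))) x =
      (\<Sum>i\<le>Suc n. \<Sum>s\<in>{1..3}. A' i s / (x + of_nat i) ^ s)" if x: "x > 0" for x
  proof -
    have D: "poly D x \<noteq> 0" using x pochhammer_pos[of x "Suc n"] by (simp add: D_def poly_pden)
    have E0: "x + of_nat (Suc n) \<noteq> 0" using x by (simp add: add_nonneg_eq_0_iff)
    have E: "poly E x = (x + of_nat (Suc n)) ^ 3" by (simp add: E_def add.commute)
    have E1: "poly E x \<noteq> 0" using E0 unfolding E by (simp del: of_nat_Suc)
    have "poly p x / poly (pden (Suc (Suc n))) x
        = (poly u x * poly D x + poly w x * poly E x) / (poly D x * poly E x)"
      by (subst p) (simp add: pden_Suc[of "Suc n"] D_def E_def)
    also have "\<dots> = poly w x / poly D x + poly u x / poly E x"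
      using D E1 by (simp add: add_divide_distrib)
    also have "\<dots> = (\<Sum>i\<le>Suc n. \<Sum>s\<in>{1..3}. A' i s / (x + of_nat i) ^ s)"
      using A(2)[OF x] a(2)[OF E0] A'[of "\<lambda>i f. \<Sum>s\<in>{1..3}. f s / (x + of_nat i) ^ s"]
      unfolding E by simp
    finally show ?thesis .
  qed
  from 1 2 show ?case by blast
qed

text \<open>One degree below the bound of \<open>partial_fractions_aux\<close>: the fraction is of
  order \<open>1 / x ^ 2\<close> at infinity, so its residues sum to 0.\<close>

lemma partial_fractions:
  fixes p :: "rat poly"
  assumes "degree p \<le> 3 * n + 1"
  shows "\<exists>A::nat \<times> nat \<Rightarrow> rat. (\<Sum>i\<le>n. A (i, 1)) = 0 \<and>
    (\<forall>x>0. poly p x / pochhammer x (n + 1) ^ 3 = (\<Sum>q\<in>idx n. A q / (x + of_nat (fst q)) ^ snd q))"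
proof -
  have "coeff p (3 * n + 2) = 0" using assms by (intro coeff_eq_0) auto
  with partial_fractions_aux[of p n] assms obtain A :: "nat \<Rightarrow> nat \<Rightarrow> rat" where
    "(\<Sum>i\<le>n. A i 1) = 0"
    "\<And>x. x > 0 \<Longrightarrow> poly p x / poly (pden (Suc n)) x = (\<Sum>i\<le>n. \<Sum>s\<in>{1..3}. A i s / (x + of_nat i) ^ s)"
    by auto
  then show ?thesis
    by (intro exI[of _ "\<lambda>(i, s). A i s"]) (auto simp: sum_idx poly_pden)
qed

section \<open>Evaluation and substitution in two variables\<close>

lemma eval2_pCons:
  fixes h :: "'a::zero \<Rightarrow> 'b::comm_ring_1"
  assumes "h 0 = 0"
  shows "eval2 h (pCons c P) x y = poly (map_poly h c) x + y * eval2 h P x y"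
  using assms by (simp add: eval2_def map_poly_pCons)

lemma eval2_0: "eval2 h 0 x y = 0"
  by (simp add: eval2_def)

lemma poly_map_of_rat: "poly (map_poly of_rat p) (of_rat x) = (of_rat (poly p x) :: 'a::field_char_0)"
proof (induction p)
  case (pCons a p)
  then show ?case by (simp only: map_poly_pCons[of of_rat, OF of_rat_0] poly_pCons of_rat_add of_rat_mult)
qed simp

text \<open>Transfers the summand to \<open>rat\<close>, where the partial fractions are computed so
  that their coefficients are rational.\<close>

lemma eval2_of_rat:
  "eval2 of_rat P (of_rat x) (of_rat y) = (of_rat (poly (poly P [:y:]) x) :: 'a::field_char_0)"
proof (induction P)
  case 0
  show ?case by (simp only: eval2_0 poly_0 of_rat_0)
next
  case (pCons a P)
  then show ?case
    by (simp only: eval2_pCons[of of_rat, OF of_rat_0] poly_map_of_rat poly_pCons poly_add poly_mult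
        of_rat_add of_rat_mult poly_0 mult_zero_right add_0_right)
qed

text \<open>Turns the symmetry of \<open>P\<close>, an identity of polynomials, into a functional
  equation for its values.\<close>

lemma poly_subst2:
  fixes P A B :: "'a::comm_ring_1 poly poly"
  shows "poly (poly (subst2 P A B) [:y:]) x
       = poly (poly P [:poly (poly B [:y:]) x:]) (poly (poly A [:y:]) x)"
proof (induction P)
  case 0 then show ?case by (simp add: subst2_def eval2_0)
next
  case (pCons c P)
  have "poly (poly (poly (map_poly (\<lambda>c. [:[:c:]:]) c) A) [:y:]) x = poly c (poly (poly A [:y:]) x)"
    by (induction c) (simp_all add: map_poly_pCons)
  with pCons.IH show ?case
    by (simp add: subst2_def eval2_pCons)
qed

lemma poly_poly_const_sum:
  fixes P :: "'a::comm_ring_1 poly poly"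
  assumes "degree P \<le> d"
  shows "poly (poly P [:y:]) x = (\<Sum>b\<le>d. poly (coeff P b) x * y ^ b)"
proof -
  have "poly P [:y:] = (\<Sum>b\<le>d. coeff P b * [:y:] ^ b)"
    by (rule poly_eq_sum_le) (use assms in auto)
  then show ?thesis by (simp add: poly_sum)
qed

section \<open>Partial fractions in two variables\<close>

text \<open>Sorting \<open>P\<close> by powers of \<open>k2\<close> makes it a sum of products of
  one-variable polynomials; both factors are expanded separately.\<close>

lemma partial_fractions2:
  fixes P :: "rat poly poly" and n r1 r2 :: nat
  assumes d1: "degree1_le P (3 * n + 1)" and d2: "degree2_le P (3 * n + 1)"
    and sym: "subst2 P (var2 + of_nat r2 - of_nat r1) (var1 + of_nat r1 - of_nat r2) = - P"
  shows "\<exists>c :: nat \<times> nat \<Rightarrow> nat \<times> nat \<Rightarrow> rat.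
     (\<forall>p q. c q p = - c p q) \<and> (\<forall>q. (\<Sum>i\<le>n. c (i, 1) q) = 0) \<and>
     (\<forall>x>0. \<forall>y>0. poly (poly P [:y - of_nat r2:]) (x - of_nat r1)
          / (pochhammer x (n + 1) ^ 3 * pochhammer y (n + 1) ^ 3)
        = (\<Sum>p\<in>idx n. \<Sum>q\<in>idx n. c p q / ((x + of_nat (fst p)) ^ snd p * (y + of_nat (fst q)) ^ snd q)))"
proof -
  let ?d = "3 * n + 1"
  define G where "G = (\<lambda>x y. poly (poly P [:y - of_nat r2:]) (x - of_nat r1) :: rat)"
  define W where "W = (\<lambda>(x::rat) (y::rat) (p::nat\<times>nat) (q::nat\<times>nat). (x + of_nat (fst p)) ^ snd p * (y + of_nat (fst q)) ^ snd q)"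
  define d where "d = (\<lambda>x::rat. pochhammer x (n + 1) ^ 3)"
  \<comment> \<open>In the coordinates \<open>x = k1 + r1\<close>, \<open>y = k2 + r2\<close> the
    given substitution exchanges \<open>x\<close> and \<open>y\<close>.\<close>
  have anti: "G y x = - G x y" for x y
  proof -
    have "poly (poly (subst2 P (var2 + of_nat r2 - of_nat r1) (var1 + of_nat r1 - of_nat r2))
        [:y - of_nat r2:]) (x - of_nat r1) = - G x y"
      unfolding sym G_def by simp
    then show ?thesis unfolding poly_subst2 G_def
      by (simp add: var1_def var2_def of_nat_poly algebra_simps)
  qed
  define pf where "pf = (\<lambda>(f :: rat \<Rightarrow> rat) (A :: nat \<times> nat \<Rightarrow> rat). (\<Sum>i\<le>n. A (i, 1)) = 0 \<and>
      (\<forall>x>0. f x / d x = (\<Sum>q\<in>idx n. A q / (x + of_nat (fst q)) ^ snd q)))"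
  have "\<exists>A. pf (\<lambda>x. poly (coeff P b) (x - of_nat r1)) A" for b
  proof -
    have "degree (pcompose (coeff P b) [:- of_nat r1, 1:]) \<le> ?d"
      using d1 by (simp add: degree1_le_def degree_pcompose)
    from partial_fractions[OF this] show ?thesis
      unfolding pf_def d_def by (simp add: poly_pcompose)
  qed
  then obtain A where pfA: "\<And>b. pf (\<lambda>x. poly (coeff P b) (x - of_nat r1)) (A b)"
    by metis
  have "\<exists>A. b \<le> ?d \<longrightarrow> pf (\<lambda>x. (x - of_nat r2) ^ b) A" for b
  proof (cases "b \<le> ?d")
    case True
    then have "degree ([:- of_nat r2, 1 :: rat:] ^ b) \<le> ?d"
      by (simp add: degree_linear_power)
    from partial_fractions[OF this] show ?thesis
      unfolding pf_def d_def by simp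
  qed auto
  then obtain B where pfB: "\<And>b. b \<le> ?d \<Longrightarrow> pf (\<lambda>x. (x - of_nat r2) ^ b) (B b)"
    by metis
  note A = pfA[unfolded pf_def, THEN conjunct1] pfA[unfolded pf_def, THEN conjunct2, rule_format]
  note B = pfB[unfolded pf_def, THEN conjunct1] pfB[unfolded pf_def, THEN conjunct2, rule_format]
  define c0 where "c0 = (\<lambda>p q. \<Sum>b\<le>?d. A b p * B b q)"
  \<comment> \<open>Antisymmetrising the coefficients makes the uniqueness of partial fractions unnecessary.\<close>
  define c where "c = (\<lambda>p q. (c0 p q - c0 q p) / 2)"
  have c0: "G x y / (d x * d y) = (\<Sum>p\<in>idx n. \<Sum>q\<in>idx n. c0 p q / W x y p q)"
    if xy: "x > 0" "y > 0" for x y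
  proof -
    have "G x y / (d x * d y)
        = (\<Sum>b\<le>?d. (poly (coeff P b) (x - of_nat r1) / d x) * ((y - of_nat r2) ^ b / d y))"
      using d2 unfolding G_def degree2_le_def
      by (simp add: poly_poly_const_sum[of P ?d] sum_divide_distrib del: sum.atMost_Suc power_Suc)
    also have "\<dots> = (\<Sum>b\<le>?d. \<Sum>p\<in>idx n. \<Sum>q\<in>idx n. A b p * B b q / W x y p q)"
      using xy by (intro sum.cong refl) (simp add: A B W_def sum_product)
    also have "\<dots> = (\<Sum>p\<in>idx n. \<Sum>b\<le>?d. \<Sum>q\<in>idx n. A b p * B b q / W x y p q)"
      by (rule sum.swap)
    also have "\<dots> = (\<Sum>p\<in>idx n. \<Sum>q\<in>idx n. \<Sum>b\<le>?d. A b p * B b q / W x y p q)"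
      by (rule sum.cong[OF refl], rule sum.swap)
    finally show ?thesis by (simp add: c0_def sum_divide_distrib del: sum.atMost_Suc)
  qed
  have W: "W x y p q = W y x q p" for x y p q by (simp add: W_def)
  have main: "G x y / (d x * d y) = (\<Sum>p\<in>idx n. \<Sum>q\<in>idx n. c p q / W x y p q)"
    if xy: "x > 0" "y > 0" for x y
  proof -
    have "G x y / (d x * d y) = (G x y / (d x * d y) - G y x / (d y * d x)) / 2"
      using anti[of y x] by simp
    also have "\<dots> = ((\<Sum>p\<in>idx n. \<Sum>q\<in>idx n. c0 p q / W x y p q)
        - (\<Sum>q\<in>idx n. \<Sum>p\<in>idx n. c0 q p / W y x q p)) / 2"
      unfolding c0[OF xy] c0[OF xy(2,1)] ..
    also have "(\<Sum>q\<in>idx n. \<Sum>p\<in>idx n. c0 q p / W y x q p)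
        = (\<Sum>p\<in>idx n. \<Sum>q\<in>idx n. c0 q p / W x y p q)"
      by (subst sum.swap) (simp only: W[of x y])
    finally have "G x y / (d x * d y) = ((\<Sum>p\<in>idx n. \<Sum>q\<in>idx n. c0 p q / W x y p q)
        - (\<Sum>p\<in>idx n. \<Sum>q\<in>idx n. c0 q p / W x y p q)) / 2" .
    moreover have "c p q / W x y p q = (c0 p q / W x y p q - c0 q p / W x y p q) / 2" for p q
      by (simp add: c_def diff_divide_distrib)
    ultimately show ?thesis
      by (simp only: sum_subtractf sum_divide_distrib[symmetric])
  qed
  \<comment> \<open>Antisymmetrisation mixes both arguments of \<open>c0\<close>, so its residues
    must vanish in each of them: in the first by the degree in \<open>k1\<close>, in the second by
    the degree in \<open>k2\<close>.\<close>
  have "(\<Sum>i\<le>n. c0 (i, 1) q) = 0" for q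
    unfolding c0_def by (subst sum.swap) (simp add: sum_distrib_right[symmetric] A del: One_nat_def sum.atMost_Suc)
  moreover have "(\<Sum>i\<le>n. c0 q (i, 1)) = 0" for q
    unfolding c0_def by (subst sum.swap) (simp add: sum_distrib_left[symmetric] B del: One_nat_def sum.atMost_Suc)
  ultimately have "(\<Sum>i\<le>n. c (i, 1) q) = 0" for q
    by (simp add: c_def sum_divide_distrib[symmetric] sum_subtractf del: One_nat_def)
  moreover have "c q p = - c p q" for p q
    unfolding c_def by simp
  ultimately show ?thesis
    using main unfolding G_def d_def W_def by (intro exI[of _ c] conjI allI impI)
qed

section \<open>Zeta tails and double series\<close>

text \<open>
  The value 0 at \<open>s = 1\<close> regularises the divergent series, so that \<open>ztail 1 v\<close> is minus the harmonic
  number and the identities for tails below hold uniformly in \<open>s \<ge> 1\<close>.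
\<close>

definition zreg :: "nat \<Rightarrow> real" where
  "zreg s = (if s = 1 then 0 else (\<Sum>k. 1 / real (Suc k) ^ s))"

definition ztail :: "nat \<Rightarrow> nat \<Rightarrow> real" where
  "ztail s v = zreg s - (\<Sum>k<v. 1 / real (Suc k) ^ s)"

lemma summable_zeta: "s \<ge> 2 \<Longrightarrow> summable (\<lambda>k. 1 / real (Suc k) ^ s)"
  using inverse_power_summable[of s, where ?'a = real]
  by (subst summable_Suc_iff) (simp add: inverse_eq_divide power_one_over)

lemma ztail_add: "ztail s (v + l) = ztail s v - (\<Sum>k<l. 1 / real (Suc (v + k)) ^ s)"
  by (induction l) (simp_all add: ztail_def)

lemma ztail_tendsto_0:
  assumes "s \<ge> 2"
  shows "ztail s \<longlonglongrightarrow> 0"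
proof -
  have "(\<lambda>v. zreg s - (\<Sum>k<v. 1 / real (Suc k) ^ s)) \<longlonglongrightarrow> zreg s - zreg s"
    using assms unfolding zreg_def
    by (intro tendsto_diff tendsto_const) (auto intro!: summable_LIMSEQ summable_zeta simp del: of_nat_Suc)
  then show ?thesis unfolding ztail_def by simp
qed

lemma inverse_power_shift_tendsto_0:
  assumes "s \<ge> 1"
  shows "(\<lambda>N. 1 / real (Suc (N + k)) ^ s) \<longlonglongrightarrow> 0"
proof (rule Lim_null_comparison)
  show "(\<lambda>N. 1 / real (Suc N)) \<longlonglongrightarrow> 0"
    using LIMSEQ_inverse_real_of_nat by (simp add: inverse_eq_divide)
  have "real (Suc N) \<le> real (Suc (N + k)) ^ s" for N
  proof -
    have "real (Suc N) \<le> real (Suc (N + k)) ^ 1" by simp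
    also have "\<dots> \<le> real (Suc (N + k)) ^ s" using assms by (intro power_increasing) auto
    finally show ?thesis .
  qed
  then show "\<forall>\<^sub>F N in sequentially. norm (1 / real (Suc (N + k)) ^ s) \<le> 1 / real (Suc N)"
    by (intro always_eventually allI) (simp add: frac_le del: of_nat_Suc)
qed

text \<open>Holds for \<open>s = 1\<close> too, where \<open>ztail\<close> diverges: the difference
  consists of \<open>l\<close> terms, each tending to 0.\<close>

lemma ztail_shift_tendsto_0:
  assumes "s \<ge> 1"
  shows "(\<lambda>N. ztail s (N + l) - ztail s N) \<longlonglongrightarrow> 0"
proof -
  have "(\<lambda>N. - (\<Sum>k<l. 1 / real (Suc (N + k)) ^ s)) \<longlonglongrightarrow> - (\<Sum>k<l. 0)"
    using assms by (intro tendsto_minus tendsto_sum inverse_power_shift_tendsto_0)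
  then show ?thesis by (simp add: ztail_add)
qed

lemma ztail_1: "ztail 1 v = - harm v"
proof -
  have "(\<Sum>k<v. 1 / real (Suc k) ^ 1) = harm v"
    by (induction v) (simp_all add: harm_Suc harm_expand inverse_eq_divide)
  then show ?thesis by (simp add: ztail_def zreg_def)
qed

text \<open>Makes the boundary terms vanish when a sum of tails is reindexed. Even at
  \<open>s = 1\<close> the tail grows only logarithmically.\<close>

lemma ztail_div_power_tendsto_0:
  assumes "s \<ge> 1" "t \<ge> 1"
  shows "(\<lambda>N. ztail s N / real N ^ t) \<longlonglongrightarrow> 0"
proof (rule Lim_null_comparison)
  show "(\<lambda>N. \<bar>ztail s N / real N\<bar>) \<longlonglongrightarrow> 0"
  proof (rule tendsto_rabs_zero, cases "s = 1")
    case True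
    have "(\<lambda>N. (harm N - ln (real N)) * (1 / real N) + ln (real N) / real N) \<longlonglongrightarrow>
        euler_mascheroni * 0 + (0 :: real)"
      by (intro tendsto_add tendsto_mult euler_mascheroni_LIMSEQ lim_1_over_n lim_ln_over_n)
    then have "(\<lambda>N. harm N / real N) \<longlonglongrightarrow> 0"
      by (simp add: diff_divide_distrib)
    from tendsto_minus[OF this] True show "(\<lambda>N. ztail s N / real N) \<longlonglongrightarrow> 0"
      by (simp add: ztail_1[simplified])
  next
    case False
    with assms have "s \<ge> 2" by simp
    from tendsto_mult[OF ztail_tendsto_0[OF this] lim_1_over_n]
    show "(\<lambda>N. ztail s N / real N) \<longlonglongrightarrow> 0" by simp
  qed
  have "norm (ztail s N / real N ^ t) \<le> \<bar>ztail s N / real N\<bar>" if "N \<ge> 1" for N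
  proof -
    have "real N ^ 1 \<le> real N ^ t" using assms that by (intro power_increasing) auto
    then show ?thesis using that by (simp add: abs_divide frac_le)
  qed
  then show "\<forall>\<^sub>F N in sequentially. norm (ztail s N / real N ^ t) \<le> \<bar>ztail s N / real N\<bar>"
    using eventually_sequentially by blast
qed

text \<open>The summation over \<open>x\<close>. Terms with \<open>s p = 1\<close> diverge one by
  one, but their coefficients sum to 0, so the harmonic growth cancels and the regularised tails
  give the value.\<close>

lemma sum_ztail_sums:
  fixes c :: "'i \<Rightarrow> real"
  assumes I: "finite I" "\<And>p. p \<in> I \<Longrightarrow> s p \<ge> 1"
    and c: "(\<Sum>p\<in>{p\<in>I. s p = 1}. c p) = 0"
  shows "(\<lambda>d. \<Sum>p\<in>I. c p / real (Suc (w p + d)) ^ s p) sums (\<Sum>p\<in>I. c p * ztail (s p) (w p))"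
proof -
  \<comment> \<open>Every tail at \<open>D + w p\<close> is compared with the one at
    \<open>D\<close>. After that the terms with \<open>s p = 1\<close> share the factor
    \<open>ztail 1 D\<close> and cancel by \<open>c\<close>.\<close>
  have part: "(\<Sum>d<D. \<Sum>p\<in>I. c p / real (Suc (w p + d)) ^ s p) =
      (\<Sum>p\<in>I. c p * ztail (s p) (w p)) - ((\<Sum>p\<in>I. c p * (ztail (s p) (D + w p) - ztail (s p) D))
        + (\<Sum>p\<in>{p\<in>I. s p \<noteq> 1}. c p * ztail (s p) D))" for D
  proof -
    have "(\<Sum>d<D. \<Sum>p\<in>I. c p / real (Suc (w p + d)) ^ s p)
        = (\<Sum>p\<in>I. c p * (\<Sum>d<D. 1 / real (Suc (w p + d)) ^ s p))"
      by (subst sum.swap) (simp add: sum_distrib_left)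
    also have "\<dots> = (\<Sum>p\<in>I. c p * ztail (s p) (w p)) - (\<Sum>p\<in>I. c p * ztail (s p) (D + w p))"
    proof -
      have "ztail (s p) (D + w p) = ztail (s p) (w p) - (\<Sum>d<D. 1 / real (Suc (w p + d)) ^ s p)" for p
        unfolding add.commute[of D "w p"] by (rule ztail_add)
      then show ?thesis by (simp add: right_diff_distrib sum_subtractf del: of_nat_Suc)
    qed
    also have "(\<Sum>p\<in>I. c p * ztail (s p) (D + w p))
        = (\<Sum>p\<in>I. c p * (ztail (s p) (D + w p) - ztail (s p) D)) + (\<Sum>p\<in>I. c p * ztail (s p) D)"
      unfolding sum.distrib[symmetric] by (simp add: right_diff_distrib)
    also have "(\<Sum>p\<in>I. c p * ztail (s p) D)
        = (\<Sum>p\<in>{p\<in>I. s p = 1}. c p * ztail (s p) D) + (\<Sum>p\<in>{p\<in>I. s p \<noteq> 1}. c p * ztail (s p) D)"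
      using I(1) by (subst sum.union_disjoint[symmetric]) (auto intro!: sum.cong)
    also have "(\<Sum>p\<in>{p\<in>I. s p = 1}. c p * ztail (s p) D) = (\<Sum>p\<in>{p\<in>I. s p = 1}. c p) * ztail 1 D"
      by (simp add: sum_distrib_right)
    finally show ?thesis unfolding c mult_zero_left add_0_left .
  qed
  have "ztail (s p) \<longlonglongrightarrow> 0" if "p \<in> {p\<in>I. s p \<noteq> 1}" for p
    using that I(2)[of p] by (intro ztail_tendsto_0) auto
  then have "(\<lambda>D. (\<Sum>p\<in>I. c p * ztail (s p) (w p)) -
      ((\<Sum>p\<in>I. c p * (ztail (s p) (D + w p) - ztail (s p) D))
        + (\<Sum>p\<in>{p\<in>I. s p \<noteq> 1}. c p * ztail (s p) D))) \<longlonglongrightarrow>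
      (\<Sum>p\<in>I. c p * ztail (s p) (w p)) - ((\<Sum>p\<in>I. c p * 0) + (\<Sum>p\<in>{p\<in>I. s p \<noteq> 1}. c p * 0))"
    using I by (intro tendsto_diff tendsto_add tendsto_const tendsto_sum tendsto_mult ztail_shift_tendsto_0) auto
  then show ?thesis unfolding sums_def part by simp
qed

lemma ztail_sums:
  assumes "s \<ge> 2"
  shows "(\<lambda>d. 1 / real (Suc (w + d)) ^ s) sums ztail s w"
proof -
  have "(\<lambda>d. \<Sum>p\<in>{()}. 1 / real (Suc (w + d)) ^ s) sums (\<Sum>p\<in>{()}. 1 * ztail s w)"
    using assms by (intro sum_ztail_sums[where c = "\<lambda>_. 1 :: real" and s = "\<lambda>_. s"]) auto
  then show ?thesis by (simp del: of_nat_Suc sum_constant)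
qed

section \<open>Double series and zeta values\<close>

text \<open>A Fubini argument: the product of two copies of the series for zeta(2) dominates
  \<open>f\<close>, so the unconditional sum exists and equals the iterated one.\<close>

lemma has_sum_iterated:
  fixes f :: "nat \<times> nat \<Rightarrow> real"
  assumes bound: "\<And>v d. \<bar>f (v, d)\<bar> \<le> C * (1 / real (Suc v) ^ 2 * (1 / real (Suc d) ^ 2))"
    and inner: "\<And>v. (\<lambda>d. f (v, d)) sums g v"
  shows "summable g" "(f has_sum suminf g) UNIV"
proof -
  let ?z = "\<lambda>k. 1 / real (Suc k) ^ 2"
  have z: "summable ?z" using summable_zeta[of 2] by simp
  have zs: "(?z has_sum suminf ?z) UNIV"
    by (rule norm_summable_imp_has_sum) (use z in \<open>auto simp: summable_sums\<close>)
  have "(\<lambda>p. C * (?z (fst p) * ?z (snd p))) summable_on Sigma UNIV (\<lambda>_. UNIV)"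
  proof (intro summable_on_cmult_right summable_on_SigmaI)
    fix v show "((\<lambda>d. ?z (fst (v, d)) * ?z (snd (v, d))) has_sum ?z v * suminf ?z) UNIV"
      using has_sum_cmult_right[OF zs, of "?z v"] by simp
  next
    show "(\<lambda>v. ?z v * suminf ?z) summable_on UNIV"
      using zs by (intro summable_on_cmult_left) (auto simp: summable_on_def)
  qed auto
  then have "(\<lambda>p. C * (?z (fst p) * ?z (snd p))) summable_on UNIV" by simp
  then have "(\<lambda>p. norm (f p)) summable_on UNIV"
    by (rule summable_on_comparison_test) (use bound in auto)
  then have "f summable_on UNIV" by (rule abs_summable_summable)
  then obtain S where S: "(f has_sum S) UNIV" by (auto simp: summable_on_def)
  have inner': "((\<lambda>d. f (v, d)) has_sum g v) UNIV" for v
  proof (rule norm_summable_imp_has_sum[OF _ inner])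
    show "summable (\<lambda>d. norm (f (v, d)))"
    proof (rule summable_comparison_test'[where N = 0])
      show "summable (\<lambda>d. C * (?z v * ?z d))" by (intro summable_mult z)
    qed (use bound in auto)
  qed
  have "(g has_sum S) UNIV"
    by (rule has_sum_SigmaD[where f = f and B = "\<lambda>_. UNIV"]) (use S inner' in auto)
  then have "g sums S" by (rule has_sum_imp_sums)
  then show "summable g" "(f has_sum suminf g) UNIV" using S by (auto simp: sums_iff)
qed

lemma mzv_singleton:
  assumes "s \<ge> 2"
  shows "mzv [s] = zreg s"
proof -
  have "mzv [s] = (\<Sum>\<^sub>\<infinity>k. 1 / real (Suc k) ^ s)"
    unfolding mzv_def
    by (rule infsum_reindex_bij_witness[where i = "\<lambda>k. [Suc k]" and j = "\<lambda>l. hd l - 1"])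
       (auto simp: length_Suc_conv simp del: of_nat_Suc)
  also have "\<dots> = zreg s"
    using norm_summable_imp_has_sum[of "\<lambda>k. 1 / real (Suc k) ^ s"] summable_zeta[OF assms] assms
    by (auto simp: zreg_def summable_sums intro!: infsumI simp del: of_nat_Suc)
  finally show ?thesis .
qed

lemma mzv_pair:
  assumes "s \<ge> 2" "t \<ge> 2"
  shows "(\<lambda>v. ztail s (Suc v) / real (Suc v) ^ t) sums mzv [s, t]"
proof -
  \<comment> \<open>The parametrisation \<open>k2 = v + 1\<close>, \<open>k1 = v + 2 + d\<close> of
    the pairs \<open>k1 > k2 \<ge> 1\<close>.\<close>
  define f where "f = (\<lambda>(v, d). 1 / real (Suc (Suc v + d)) ^ s * (1 / real (Suc v) ^ t))"
  have p2: "1 / x ^ k \<le> 1 / y ^ 2" if "k \<ge> 2" "y \<ge> 1" "x \<ge> y" for x y :: real and k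
  proof -
    have "y ^ 2 \<le> x ^ 2" using that by (intro power_mono) auto
    also have "\<dots> \<le> x ^ k" using that by (intro power_increasing) auto
    finally show ?thesis using that by (intro divide_left_mono) auto
  qed
  have bound: "\<bar>f (v, d)\<bar> \<le> 1 * (1 / real (Suc v) ^ 2 * (1 / real (Suc d) ^ 2))" for v d
  proof -
    have "\<bar>f (v, d)\<bar> = 1 / real (Suc v) ^ t * (1 / real (Suc (Suc v + d)) ^ s)"
      by (simp add: f_def del: of_nat_Suc)
    also have "\<dots> \<le> 1 / real (Suc v) ^ 2 * (1 / real (Suc d) ^ 2)"
      using assms by (intro mult_mono p2) auto
    finally show ?thesis by simp
  qed
  have inner: "(\<lambda>d. f (v, d)) sums (ztail s (Suc v) / real (Suc v) ^ t)" for v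
  proof -
    from sums_mult2[OF ztail_sums[OF assms(1)], of "Suc v" "1 / real (Suc v) ^ t"] show ?thesis
      by (simp add: f_def del: of_nat_Suc)
  qed
  note * = has_sum_iterated[of f 1, OF bound inner]
  have "mzv [s, t] = infsum f UNIV"
    unfolding mzv_def
  proof (rule infsum_reindex_bij_witness[where i = "\<lambda>(v, d). [Suc (Suc v + d), Suc v]" and
      j = "\<lambda>l. (l ! 1 - 1, l ! 0 - l ! 1 - 1)"])
  qed (auto simp: length_Suc_conv f_def numeral_2_eq_2 lessThan_Suc)
  also have "\<dots> = suminf (\<lambda>v. ztail s (Suc v) / real (Suc v) ^ t)"
    using *(2) by (rule infsumI)
  finally show ?thesis using *(1) by (simp add: summable_sums)
qed

section \<open>The rational span of 1, zeta(2) and zeta(3)\<close>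

definition zspan :: "real set" where
  "zspan = {of_rat a + of_rat b * zreg 2 + of_rat c * zreg 3 | a b c. True}"

lemma zspan_add: "x \<in> zspan \<Longrightarrow> y \<in> zspan \<Longrightarrow> x + y \<in> zspan"
proof -
  assume "x \<in> zspan" "y \<in> zspan"
  then obtain a b c a' b' c' where "x = of_rat a + of_rat b * zreg 2 + of_rat c * zreg 3"
    "y = of_rat a' + of_rat b' * zreg 2 + of_rat c' * zreg 3" unfolding zspan_def by auto
  then have "x + y = of_rat (a + a') + of_rat (b + b') * zreg 2 + of_rat (c + c') * zreg 3"
    by (simp add: of_rat_add algebra_simps)
  then show ?thesis unfolding zspan_def by blast
qed

lemma zspan_scale: "x \<in> zspan \<Longrightarrow> of_rat q * x \<in> zspan"
proof -
  assume "x \<in> zspan"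
  then obtain a b c where "x = of_rat a + of_rat b * zreg 2 + of_rat c * zreg 3"
    unfolding zspan_def by auto
  then have "of_rat q * x = of_rat (q * a) + of_rat (q * b) * zreg 2 + of_rat (q * c) * zreg 3"
    by (simp add: of_rat_mult algebra_simps)
  then show ?thesis unfolding zspan_def by blast
qed

lemma zspan_rat: "of_rat q \<in> zspan"
proof -
  have "of_rat q = of_rat q + of_rat 0 * zreg 2 + of_rat 0 * zreg 3" by simp
  then show ?thesis unfolding zspan_def by blast
qed

lemma zspan_zreg: "s \<in> {1..3} \<Longrightarrow> zreg s \<in> zspan"
proof -
  assume "s \<in> {1..3}"
  then consider "s = 1" | "s = 2" | "s = 3" by force
  then show ?thesis
  proof cases
    case 1 then show ?thesis using zspan_rat[of 0] by (simp add: zreg_def)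
  next
    case 2
    have "zreg 2 = of_rat 0 + of_rat 1 * zreg 2 + of_rat 0 * zreg 3" by simp
    then show ?thesis unfolding 2 zspan_def by blast
  next
    case 3
    have "zreg 3 = of_rat 0 + of_rat 0 * zreg 2 + of_rat 1 * zreg 3" by simp
    then show ?thesis unfolding 3 zspan_def by blast
  qed
qed

lemma zspan_diff: "x \<in> zspan \<Longrightarrow> y \<in> zspan \<Longrightarrow> x - y \<in> zspan"
  using zspan_add[of x "of_rat (-1) * y"] zspan_scale[of y "-1"] by simp

lemma zspan_sum: "(\<And>i. i \<in> I \<Longrightarrow> f i \<in> zspan) \<Longrightarrow> sum f I \<in> zspan"
  by (induction I rule: infinite_finite_induct) (use zspan_rat[of 0] in \<open>auto intro: zspan_add\<close>)

text \<open>A tail differs from \<open>zreg s\<close> by a rational number, and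
  \<open>zreg 1 = 0\<close>.\<close>

lemma zspan_ztail:
  assumes "s \<in> {1..3}"
  shows "ztail s v \<in> zspan"
proof -
  have "1 / real (Suc k) ^ s = of_rat (1 / of_nat (Suc k) ^ s)" for k
    by (simp add: of_rat_divide of_rat_power del: of_nat_Suc)
  then show ?thesis unfolding ztail_def using assms
    by (intro zspan_diff zspan_zreg zspan_sum) (auto intro: zspan_rat simp del: of_nat_Suc)
qed

lemma shifted_series_power:
  assumes "s \<in> {2..3}"
  shows "\<exists>z\<in>zspan. (\<lambda>k. 1 / real (Suc (k + w)) ^ s) sums z"
proof
  show "(\<lambda>k. 1 / real (Suc (k + w)) ^ s) sums (ztail s w)"
    using assms ztail_sums[of s w] by (simp add: add.commute[of _ w] del: of_nat_Suc)
  show "ztail s w \<in> zspan" using assms by (intro zspan_ztail) auto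
qed

text \<open>With \<open>b = a + l\<close> one has \<open>1 / (a ^ t * b ^ s) = (1 / (a ^ t * b ^ (s
  - 1)) - 1 / (a ^ (t - 1) * b ^ s)) / l\<close>. This lowers the total exponent until a single
  power or the case \<open>s = t = 1\<close> is left.\<close>

lemma shifted_series:
  assumes "l \<ge> 1" "s + t \<ge> 2" "s \<le> 3" "t \<le> 3"
  shows "\<exists>z\<in>zspan. (\<lambda>k. 1 / (real (Suc (k + w)) ^ t * real (Suc (k + w + l)) ^ s)) sums z"
  using assms(2-4)
proof (induction "s + t" arbitrary: s t rule: less_induct)
  case less
  let ?a = "\<lambda>k. real (Suc (k + w))" and ?b = "\<lambda>k. real (Suc (k + w + l))"
  have l: "of_rat (1 / of_nat l) = 1 / real l" by (simp add: of_rat_divide)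
  consider "s = 0" | "t = 0" | "s = 1" "t = 1" | "s \<ge> 1" "t \<ge> 1" "s + t \<ge> 3" by linarith
  then show ?case
  proof cases
    case 1
    with less.prems show ?thesis using shifted_series_power[of t w] by simp
  next
    case 2
    with less.prems show ?thesis using shifted_series_power[of s "w + l"] by (simp add: add.assoc)
  next
    case 3
    \<comment> \<open>For \<open>s = t = 1\<close> the two harmonic series diverge separately; their
      coefficients 1 and -1 sum to 0, so \<open>sum_ztail_sums\<close> applies with
      \<open>bool\<close> as index set.\<close>
    define c where "c = (\<lambda>b. if b then 1 else - 1 :: real)"
    define u where "u = (\<lambda>b. if b then w else w + l)"
    have "(\<lambda>d. \<Sum>b\<in>UNIV. c b / real (Suc (u b + d)) ^ 1) sums (\<Sum>b\<in>UNIV. c b * ztail 1 (u b))"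
      by (rule sum_ztail_sums) (auto simp: c_def UNIV_bool)
    then have "(\<lambda>d. 1 / ?a d - 1 / ?b d) sums (ztail 1 w - ztail 1 (w + l))"
      by (simp add: c_def u_def UNIV_bool ac_simps)
    from sums_mult[OF this, of "1 / real l"]
    have "(\<lambda>d. 1 / real l * (1 / ?a d - 1 / ?b d)) sums (1 / real l * (ztail 1 w - ztail 1 (w + l)))" .
    moreover have "1 / real l * (1 / ?a d - 1 / ?b d) = 1 / (?a d ^ t * ?b d ^ s)" for d
    proof -
      have "?a d > 0" "?b d > 0" "real l > 0" "?b d = ?a d + real l" using assms(1) by auto
      then show ?thesis unfolding 3 by (simp add: divide_simps del: of_nat_Suc)
    qed
    moreover have "1 / real l * (ztail 1 w - ztail 1 (w + l)) \<in> zspan"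
      unfolding l[symmetric] by (intro zspan_scale zspan_diff zspan_ztail) auto
    ultimately show ?thesis by auto
  next
    case 4
    obtain s' t' where st: "s = Suc s'" "t = Suc t'" using 4 by (cases s; cases t) auto
    from less.hyps[of s' t] less.prems 4 st obtain z1 where z1: "z1 \<in> zspan"
      "(\<lambda>k. 1 / (?a k ^ t * ?b k ^ s')) sums z1" by auto
    from less.hyps[of s t'] less.prems 4 st obtain z2 where z2: "z2 \<in> zspan"
      "(\<lambda>k. 1 / (?a k ^ t' * ?b k ^ s)) sums z2" by auto
    have "(\<lambda>k. 1 / real l * (1 / (?a k ^ t * ?b k ^ s') - 1 / (?a k ^ t' * ?b k ^ s)))
        sums (1 / real l * (z1 - z2))"
      by (intro sums_mult sums_diff z1 z2)
    moreover have "1 / real l * (1 / (?a d ^ t * ?b d ^ s') - 1 / (?a d ^ t' * ?b d ^ s))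
        = 1 / (?a d ^ t * ?b d ^ s)" for d
    proof -
      define a b where "a = ?a d" and "b = ?b d"
      have "a > 0" "b > 0" "real l > 0" "b = a + real l" using assms(1) by (auto simp: a_def b_def)
      have "1 / (a ^ t * b ^ s') - 1 / (a ^ t' * b ^ s) = (b - a) / (a ^ t * b ^ s)"
        unfolding st using \<open>a > 0\<close> \<open>b > 0\<close> by (simp add: divide_simps)
      also have "b - a = real l" using \<open>b = a + real l\<close> by simp
      finally show ?thesis using \<open>real l > 0\<close> unfolding a_def b_def by simp
    qed
    moreover have "1 / real l * (z1 - z2) \<in> zspan"
      unfolding l[symmetric] by (intro zspan_scale zspan_diff z1 z2)
    ultimately show ?thesis by auto
  qed
qed

section \<open>The linear form\<close>

text \<open>Only the difference of partial sums is claimed to converge, since for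
  \<open>s = t = 1\<close> each of the two sums diverges.\<close>

lemma shifted_double_tail:
  assumes st: "s \<in> {1..3}" "t \<in> {1..3}"
  shows "\<exists>z\<in>zspan. (\<lambda>N. (\<Sum>v<N. ztail s (Suc (v + a) + e) / real (Suc (v + a)) ^ t)
      - (\<Sum>v<N. ztail s (Suc v) / real (Suc v) ^ t)) \<longlonglongrightarrow> z"
proof -
  define G where "G = (\<lambda>v. ztail s (Suc v) / real (Suc v) ^ t)"
  define X where "X = (\<lambda>k v. 1 / (real (Suc (v + a)) ^ t * real (Suc (v + a + Suc k)) ^ s))"
  have "\<exists>z\<in>zspan. X k sums z" for k
    using shifted_series[of "Suc k" s t a] st unfolding X_def by auto
  then obtain z where z: "\<And>k. z k \<in> zspan" "\<And>k. X k sums z k" by metis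
  \<comment> \<open>Moving the start of the tail back by \<open>e\<close> costs \<open>e\<close>
    terms. Their distances from \<open>Suc (v + a)\<close> are \<open>Suc k \<ge> 1\<close>, as
    \<open>shifted_series\<close> requires.\<close>
  have h: "ztail s (Suc (v + a) + e) / real (Suc (v + a)) ^ t = G (v + a) - (\<Sum>k<e. X k v)" for v
    unfolding ztail_add G_def X_def
    by (simp add: diff_divide_distrib sum_divide_distrib mult.commute del: of_nat_Suc)
  \<comment> \<open>Reindexing by \<open>a\<close> costs the first \<open>a\<close> values of
    \<open>G\<close>, which lie in \<open>zspan\<close>, and \<open>a\<close> values near
    \<open>N\<close>, which vanish in the limit.\<close>
  have shift: "(\<Sum>v<N. G (v + a)) = (\<Sum>v<N. G v) + (\<Sum>k<a. G (N + k)) - (\<Sum>k<a. G k)" for N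
  proof -
    have "(\<Sum>v<N + a. G v) = (\<Sum>v<N. G v) + (\<Sum>k<a. G (N + k))"
      by (induction a) simp_all
    moreover have "(\<Sum>v<N + a. G v) = (\<Sum>v<a. G v) + (\<Sum>v<N. G (v + a))"
      by (induction N) simp_all
    ultimately show ?thesis by simp
  qed
  have part: "(\<Sum>v<N. ztail s (Suc (v + a) + e) / real (Suc (v + a)) ^ t) - (\<Sum>v<N. G v)
      = (\<Sum>k<a. G (N + k)) - (\<Sum>k<a. G k) - (\<Sum>k<e. \<Sum>v<N. X k v)" for N
    unfolding h sum_subtractf shift by (subst sum.swap) simp
  have G0: "(\<lambda>N. G (N + k)) \<longlonglongrightarrow> 0" for k
    using LIMSEQ_ignore_initial_segment[OF ztail_div_power_tendsto_0[of s t], of "Suc k"] st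
    unfolding G_def by simp
  have "(\<lambda>N. (\<Sum>k<a. G (N + k)) - (\<Sum>k<a. G k) - (\<Sum>k<e. \<Sum>v<N. X k v))
      \<longlonglongrightarrow> (\<Sum>k<a. 0) - (\<Sum>k<a. G k) - (\<Sum>k<e. z k)"
    using z(2) unfolding sums_def by (intro tendsto_diff tendsto_sum tendsto_const G0)
  moreover have "G k \<in> zspan" for k
  proof -
    have "of_rat (1 / of_nat (Suc k) ^ t) * ztail s (Suc k) \<in> zspan"
      using st by (intro zspan_scale zspan_ztail)
    moreover have "G k = of_rat (1 / of_nat (Suc k) ^ t) * ztail s (Suc k)"
      by (simp add: G_def of_rat_divide of_rat_power del: of_nat_Suc)
    ultimately show ?thesis by simp
  qed
  then have "(\<Sum>k<a. 0) - (\<Sum>k<a. G k) - (\<Sum>k<e. z k) \<in> zspan"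
    using z(1) zspan_rat[of 0] by (intro zspan_diff zspan_sum) simp_all
  ultimately show ?thesis unfolding part[symmetric] unfolding G_def by blast
qed

section \<open>Absolute convergence\<close>

text \<open>For \<open>k \<ge> 1\<close> the numerator is at most a constant times
  \<open>k ^ (3 * n + 1)\<close>, while the denominator is at least
  \<open>k ^ (3 * n + 3)\<close>.\<close>

lemma rational_function_bound:
  fixes p :: "rat poly"
  assumes "degree p \<le> 3 * n + 1"
  shows "\<exists>C\<ge>0. \<forall>k\<ge>1. \<bar>of_rat (poly p (of_nat k)) / pochhammer (real (k + r)) (n + 1) ^ 3\<bar>
      \<le> C * (1 / real k ^ 2)"
proof -
  let ?d = "3 * n + 1"
  define C where "C = (\<Sum>i\<le>?d. \<bar>of_rat (coeff p i) :: real\<bar>)"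
  have "\<bar>of_rat (poly p (of_nat k)) / pochhammer (real (k + r)) (n + 1) ^ 3\<bar> \<le> C * (1 / real k ^ 2)"
    if k: "k \<ge> 1" for k
  proof -
    have "of_rat (poly p (of_nat k)) = (\<Sum>i\<le>?d. of_rat (coeff p i) * real k ^ i)"
      by (simp add: poly_eq_sum_le[OF assms] of_rat_sum of_rat_mult of_rat_power del: sum.atMost_Suc)
    also have "\<bar>\<dots>\<bar> \<le> (\<Sum>i\<le>?d. \<bar>of_rat (coeff p i) * real k ^ i\<bar>)" by (rule sum_abs)
    also have "\<dots> \<le> (\<Sum>i\<le>?d. \<bar>of_rat (coeff p i)\<bar> * real k ^ ?d)"
      using k by (intro sum_mono) (auto simp: abs_mult simp del: power_Suc intro!: mult_left_mono power_increasing)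
    finally have num: "\<bar>of_rat (poly p (of_nat k)) :: real\<bar> \<le> C * real k ^ ?d"
      by (simp only: C_def sum_distrib_right)
    have "(\<Prod>i<n + 1. real k) \<le> (\<Prod>i<n + 1. real (k + r) + real i)"
      by (rule prod_mono) auto
    then have "real k ^ (n + 1) \<le> pochhammer (real (k + r)) (n + 1)"
      by (simp add: pochhammer_prod lessThan_atLeast0)
    then have "(real k ^ (n + 1)) ^ 3 \<le> pochhammer (real (k + r)) (n + 1) ^ 3"
      by (rule power_mono) auto
    also have "(real k ^ (n + 1)) ^ 3 = real k ^ ?d * real k ^ 2"
      unfolding power_mult[symmetric] power_add[symmetric] by (rule arg_cong[where f = "(^) (real k)"]) simp
    finally have den: "real k ^ ?d * real k ^ 2 \<le> pochhammer (real (k + r)) (n + 1) ^ 3" .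
    have pos: "real k ^ ?d * real k ^ 2 > 0" using k by simp
    have "\<bar>of_rat (poly p (of_nat k)) / pochhammer (real (k + r)) (n + 1) ^ 3\<bar>
        = \<bar>of_rat (poly p (of_nat k))\<bar> / pochhammer (real (k + r)) (n + 1) ^ 3"
      by (simp only: abs_divide abs_of_pos[OF less_le_trans[OF pos den]])
    also have "\<dots> \<le> (C * real k ^ ?d) / (real k ^ ?d * real k ^ 2)"
      by (rule frac_le[OF order_trans[OF abs_ge_zero num] num pos den])
    also have "\<dots> = C * (1 / real k ^ 2)" using k by simp
    finally show ?thesis .
  qed
  moreover have "C \<ge> 0" unfolding C_def by (intro sum_nonneg) auto
  ultimately show ?thesis by blast
qed

lemma eval2_of_nat: "eval2 of_rat P (real x) (real y) = of_rat (poly (poly P [:of_nat y:]) (of_nat x))"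
  using eval2_of_rat[of P "of_nat x" "of_nat y", where ?'a = real] by simp

text \<open>Supplies the domination for \<open>has_sum_iterated\<close>. Each power of
  \<open>k2\<close> contributes a product of two one-variable fractions.\<close>

lemma bivariate_bound:
  fixes P :: "rat poly poly"
  assumes "degree1_le P (3 * n + 1)" "degree2_le P (3 * n + 1)"
  shows "\<exists>C\<ge>0. \<forall>k1\<ge>1. \<forall>k2\<ge>1. \<bar>eval2 of_rat P (real k1) (real k2) /
        (pochhammer (real (k1 + r1)) (n + 1) ^ 3 * pochhammer (real (k2 + r2)) (n + 1) ^ 3)\<bar>
      \<le> C * (1 / real k1 ^ 2 * (1 / real k2 ^ 2))"
proof -
  let ?d = "3 * n + 1"
  let ?f = "\<lambda>r p k. of_rat (poly p (of_nat k)) / pochhammer (real (k + r)) (n + 1) ^ 3"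
  have "\<exists>C\<ge>0. \<forall>k\<ge>1. \<bar>?f r1 (coeff P b) k\<bar> \<le> C * (1 / real k ^ 2)" for b
    using assms(1) by (intro rational_function_bound) (auto simp: degree1_le_def)
  then obtain A where A: "\<And>b. A b \<ge> 0" "\<And>b k. k \<ge> 1 \<Longrightarrow> \<bar>?f r1 (coeff P b) k\<bar> \<le> A b * (1 / real k ^ 2)"
    by metis
  have "\<exists>C. b \<le> ?d \<longrightarrow> C \<ge> 0 \<and> (\<forall>k\<ge>1. \<bar>?f r2 (monom 1 b) k\<bar> \<le> C * (1 / real k ^ 2))" for b
  proof (cases "b \<le> ?d")
    case True
    then show ?thesis
      using rational_function_bound[of "monom 1 b" n r2] degree_monom_le[of "1::rat" b] by auto
  qed auto
  then obtain B where B: "\<And>b. b \<le> ?d \<Longrightarrow> B b \<ge> 0"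
    "\<And>b k. b \<le> ?d \<Longrightarrow> k \<ge> 1 \<Longrightarrow> \<bar>?f r2 (monom 1 b) k\<bar> \<le> B b * (1 / real k ^ 2)"
    by metis
  have "\<bar>eval2 of_rat P (real k1) (real k2) /
        (pochhammer (real (k1 + r1)) (n + 1) ^ 3 * pochhammer (real (k2 + r2)) (n + 1) ^ 3)\<bar>
      \<le> (\<Sum>b\<le>?d. A b * B b) * (1 / real k1 ^ 2 * (1 / real k2 ^ 2))"
    if k: "k1 \<ge> 1" "k2 \<ge> 1" for k1 k2
  proof -
    have "degree P \<le> ?d" using assms(2) by (simp add: degree2_le_def)
    then have sum: "eval2 of_rat P (real k1) (real k2) = (\<Sum>b\<le>?d.
        of_rat (poly (coeff P b) (of_nat k1)) * of_rat (poly (monom 1 b) (of_nat k2)))"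
      by (simp only: eval2_of_nat poly_poly_const_sum of_rat_sum of_rat_mult poly_monom mult_1)
    have "\<bar>eval2 of_rat P (real k1) (real k2) /
        (pochhammer (real (k1 + r1)) (n + 1) ^ 3 * pochhammer (real (k2 + r2)) (n + 1) ^ 3)\<bar>
      = \<bar>\<Sum>b\<le>?d. ?f r1 (coeff P b) k1 * ?f r2 (monom 1 b) k2\<bar>"
      unfolding sum sum_divide_distrib times_divide_times_eq ..
    also have "\<dots> \<le> (\<Sum>b\<le>?d. \<bar>?f r1 (coeff P b) k1 * ?f r2 (monom 1 b) k2\<bar>)"
      by (rule sum_abs)
    also have "\<dots> \<le> (\<Sum>b\<le>?d. (A b * (1 / real k1 ^ 2)) * (B b * (1 / real k2 ^ 2)))"
    proof (rule sum_mono)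
      fix b assume "b \<in> {..?d}"
      then have b: "b \<le> ?d" by simp
      show "\<bar>?f r1 (coeff P b) k1 * ?f r2 (monom 1 b) k2\<bar>
          \<le> (A b * (1 / real k1 ^ 2)) * (B b * (1 / real k2 ^ 2))"
        unfolding abs_mult by (rule mult_mono[OF A(2)[OF k(1)] B(2)[OF b k(2)]]) (simp_all add: A(1))
    qed
    also have "\<dots> = (\<Sum>b\<le>?d. A b * B b) * (1 / real k1 ^ 2 * (1 / real k2 ^ 2))"
      unfolding sum_distrib_right by (intro sum.cong refl) (simp only: ac_simps)
    finally show ?thesis .
  qed
  moreover have "(\<Sum>b\<le>?d. A b * B b) \<ge> 0" using A B by (intro sum_nonneg) auto
  ultimately show ?thesis by blast
qed

section \<open>Reduction to one coefficient\<close>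

text \<open>Summing \<open>c\<close> over the poles leaves an antisymmetric 3 by 3 matrix
  \<open>K\<close> whose first row, hence first column, is 0; only the entries at (2, 3) and (3, 2)
  remain. As \<open>M\<close> is arbitrary, this applies to partial sums, before any limit.\<close>

lemma antisymmetric_form:
  fixes c :: "nat \<times> nat \<Rightarrow> nat \<times> nat \<Rightarrow> rat" and M :: "nat \<Rightarrow> nat \<Rightarrow> real"
  assumes anti: "\<And>p q. c q p = - c p q" and res: "\<And>q. (\<Sum>i\<le>n. c (i, 1) q) = 0"
  shows "(\<Sum>p\<in>idx n. \<Sum>q\<in>idx n. of_rat (c p q) * M (snd p) (snd q))
       = of_rat (\<Sum>i\<le>n. \<Sum>j\<le>n. c (i, 2) (j, 3)) * (M 2 3 - M 3 2)"
proof -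
  define K where "K = (\<lambda>s t. \<Sum>i\<le>n. \<Sum>j\<le>n. c (i, s) (j, t))"
  have K1: "K 1 t = 0" for t
    unfolding K_def by (subst sum.swap) (simp only: res sum.neutral_const)
  have K_anti: "K t s = - K s t" for s t
    unfolding K_def by (subst sum.swap) (simp add: anti[of "(_, t)" "(_, s)"] sum_negf)
  have K_diag: "K s s = 0" for s using K_anti[of s s] by linarith
  have "(\<Sum>p\<in>idx n. \<Sum>q\<in>idx n. of_rat (c p q) * M (snd p) (snd q))
      = (\<Sum>i\<le>n. \<Sum>s\<in>{1..3}. \<Sum>j\<le>n. \<Sum>t\<in>{1..3}. of_rat (c (i, s) (j, t)) * M s t)"
    by (simp only: sum_idx snd_conv)
  also have "\<dots> = (\<Sum>s\<in>{1..3}. \<Sum>i\<le>n. \<Sum>j\<le>n. \<Sum>t\<in>{1..3}. of_rat (c (i, s) (j, t)) * M s t)"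
    by (rule sum.swap)
  also have "\<dots> = (\<Sum>s\<in>{1..3}. \<Sum>i\<le>n. \<Sum>t\<in>{1..3}. \<Sum>j\<le>n. of_rat (c (i, s) (j, t)) * M s t)"
    by (rule sum.cong[OF refl], rule sum.cong[OF refl], rule sum.swap)
  also have "\<dots> = (\<Sum>s\<in>{1..3}. \<Sum>t\<in>{1..3}. \<Sum>i\<le>n. \<Sum>j\<le>n. of_rat (c (i, s) (j, t)) * M s t)"
    by (rule sum.cong[OF refl], rule sum.swap)
  also have "\<dots> = (\<Sum>s\<in>{1..3}. \<Sum>t\<in>{1..3}. of_rat (K s t) * M s t)"
    by (simp only: K_def of_rat_sum sum_distrib_right)
  also have "{1..3} = {1, 2, 3 :: nat}" by auto
  also have "(\<Sum>s\<in>{1, 2, 3}. \<Sum>t\<in>{1, 2, 3}. of_rat (K s t) * M s t) = of_rat (K 2 3) * (M 2 3 - M 3 2)"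
    using K1[of 2] K1[of 3] K_anti[of 2 1] K_anti[of 3 1] K_anti[of 3 2] K_diag[of 1] K_diag[of 2] K_diag[of 3]
    by (simp add: of_rat_minus algebra_simps)
  finally show ?thesis by (simp only: K_def)
qed

theorem theorem1p7:
  fixes n r1 r2 :: nat
    and P :: "rat poly poly"
  assumes "r1 \<ge> r2 + n + 1"
    and "degree1_le P (3 * n + 1)"
    and "degree2_le P (3 * n + 1)"
    and "subst2 P (var2 + of_nat r2 - of_nat r1) (var1 + of_nat r1 - of_nat r2) = - P"
  shows "\<exists>a b c d :: rat.
    ((\<lambda>(k1, k2). eval2 of_rat P (real k1) (real k2) /
        (pochhammer (real (k1 + r1)) (n + 1) ^ 3 * pochhammer (real (k2 + r2)) (n + 1) ^ 3))
      has_sum (of_rat a + of_rat b * mzv [2] + of_rat c * mzv [3]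
                 + of_rat d * (mzv [2, 3] - mzv [3, 2])))
      {(k1, k2). k1 \<ge> k2 \<and> k2 \<ge> 1}"
proof -
  define g where "g = (\<lambda>k1 k2. eval2 of_rat P (real k1) (real k2) /
        (pochhammer (real (k1 + r1)) (n + 1) ^ 3 * pochhammer (real (k2 + r2)) (n + 1) ^ 3))"
  obtain c where "(\<forall>p q. c q p = - c p q) \<and> (\<forall>q. (\<Sum>i\<le>n. c (i, 1) q) = 0) \<and>
     (\<forall>x>0. \<forall>y>0. poly (poly P [:y - of_nat r2:]) (x - of_nat r1)
          / (pochhammer x (n + 1) ^ 3 * pochhammer y (n + 1) ^ 3)
        = (\<Sum>p\<in>idx n. \<Sum>q\<in>idx n. c p q / ((x + of_nat (fst p)) ^ snd p * (y + of_nat (fst q)) ^ snd q)))"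
    using partial_fractions2[OF assms(2-4)] by (elim exE)
  note anti = this[THEN conjunct1, rule_format]
    and res = this[THEN conjunct2, THEN conjunct1, rule_format]
    and pf = this[THEN conjunct2, THEN conjunct2, rule_format]
  \<comment> \<open>With \<open>k2 = v + 1\<close> and \<open>k1 = k2 + d\<close>,
    \<open>Suc (w v p + d)\<close> is \<open>x + i\<close> and \<open>Suc (v + a q)\<close> is
    \<open>y + j\<close>. For fixed \<open>v\<close>, \<open>u v\<close> collects all factors free
    of \<open>d\<close>.\<close>
  define w where "w = (\<lambda>v (p :: nat \<times> nat). v + r1 + fst p)"
  define a where "a = (\<lambda>q :: nat \<times> nat. r2 + fst q)"
  define u where "u = (\<lambda>v p. \<Sum>q\<in>idx n. real_of_rat (c p q) / real (Suc (v + a q)) ^ snd q)"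
  have g: "g (Suc v + d) (Suc v) = (\<Sum>p\<in>idx n. u v p / real (Suc (w v p + d)) ^ snd p)" for v d
  proof -
    let ?x = "of_nat (Suc v + d + r1) :: rat" and ?y = "of_nat (Suc v + r2) :: rat"
    have poch: "pochhammer (real m) k = of_rat (pochhammer (of_nat m) k)" for m k
      by (simp add: pochhammer_prod of_rat_prod of_rat_add)
    have "g (Suc v + d) (Suc v) = of_rat (poly (poly P [:?y - of_nat r2:]) (?x - of_nat r1)
          / (pochhammer ?x (n + 1) ^ 3 * pochhammer ?y (n + 1) ^ 3))"
      unfolding g_def eval2_of_nat poch by (simp add: of_rat_divide of_rat_mult of_rat_power)
    also have "\<dots> = of_rat (\<Sum>p\<in>idx n. \<Sum>q\<in>idx n.
        c p q / ((?x + of_nat (fst p)) ^ snd p * (?y + of_nat (fst q)) ^ snd q))"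
      by (subst pf) (simp_all del: of_nat_Suc add: add_pos_nonneg)
    also have "\<dots> = (\<Sum>p\<in>idx n. \<Sum>q\<in>idx n.
        of_rat (c p q) / (real (Suc (w v p + d)) ^ snd p * real (Suc (v + a q)) ^ snd q))"
      by (simp add: of_rat_sum of_rat_divide of_rat_mult of_rat_power of_rat_add w_def a_def ac_simps)
    finally show ?thesis by (simp add: u_def sum_divide_distrib mult.commute del: of_nat_Suc)
  qed
  have inner: "(\<lambda>d. g (Suc v + d) (Suc v)) sums (\<Sum>p\<in>idx n. u v p * ztail (snd p) (w v p))" for v
    unfolding g
  proof (rule sum_ztail_sums)
    show "snd p \<ge> 1" if "p \<in> idx n" for p using that by (auto simp: idx_def)
    have "{p \<in> idx n. snd p = 1} = (\<lambda>i. (i, 1)) ` {..n}" by (auto simp: idx_def)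
    then have "(\<Sum>p\<in>{p \<in> idx n. snd p = 1}. u v p) = (\<Sum>i\<le>n. u v (i, 1))"
      by (simp add: sum.reindex inj_on_def)
    also have "\<dots> = (\<Sum>q\<in>idx n. of_rat (\<Sum>i\<le>n. c (i, 1) q) / real (Suc (v + a q)) ^ snd q)"
      unfolding u_def of_rat_sum sum_divide_distrib by (rule sum.swap)
    finally show "(\<Sum>p\<in>{p \<in> idx n. snd p = 1}. u v p) = 0" unfolding res by simp
  qed simp
  define M where "M = (\<lambda>s t N. \<Sum>v<N. ztail s (Suc v) / real (Suc v) ^ t)"
  define h where "h = (\<lambda>p q v. ztail (snd p) (w v p) / real (Suc (v + a q)) ^ snd q)"
  have "\<exists>z. p \<in> idx n \<longrightarrow> q \<in> idx n \<longrightarrow> z \<in> zspan \<and>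
      (\<lambda>N. (\<Sum>v<N. h p q v) - M (snd p) (snd q) N) \<longlonglongrightarrow> z" for p q
  proof (cases "p \<in> idx n \<and> q \<in> idx n")
    case True
    \<comment> \<open>The subtraction does not truncate:
      \<open>r1 + i \<ge> r2 + n + 1 \<ge> r2 + j + 1\<close>. Thus the tail starts beyond
      \<open>y + j\<close>.\<close>
    define e where "e = r1 + fst p - Suc (a q)"
    have "fst q \<le> n" using True by (auto simp: idx_def)
    then have "w v p = Suc (v + a q) + e" for v
      using assms(1) by (simp add: w_def e_def a_def)
    moreover have "snd p \<in> {1..3}" "snd q \<in> {1..3}" using True by (auto simp: idx_def)
    ultimately show ?thesis
      using shifted_double_tail[of "snd p" "snd q" "a q" e] unfolding h_def M_def by auto
  qed auto
  then obtain z where z: "\<And>p q. p \<in> idx n \<Longrightarrow> q \<in> idx n \<Longrightarrow> z p q \<in> zspan"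
    "\<And>p q. p \<in> idx n \<Longrightarrow> q \<in> idx n \<Longrightarrow> (\<lambda>N. (\<Sum>v<N. h p q v) - M (snd p) (snd q) N) \<longlonglongrightarrow> z p q"
    by metis
  define Z where "Z = (\<Sum>p\<in>idx n. \<Sum>q\<in>idx n. of_rat (c p q) * z p q)"
  define d where "d = (\<Sum>i\<le>n. \<Sum>j\<le>n. c (i, 2) (j, 3))"
  \<comment> \<open>The limit in \<open>N\<close> is taken only after this regrouping:
    \<open>M 1 1\<close> diverges, but its coefficient vanishes at every finite stage.\<close>
  have part: "(\<Sum>v<N. \<Sum>p\<in>idx n. u v p * ztail (snd p) (w v p))
      = (\<Sum>p\<in>idx n. \<Sum>q\<in>idx n. of_rat (c p q) * ((\<Sum>v<N. h p q v) - M (snd p) (snd q) N))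
        + of_rat d * (M 2 3 N - M 3 2 N)" for N
  proof -
    have "(\<Sum>v<N. \<Sum>p\<in>idx n. u v p * ztail (snd p) (w v p))
        = (\<Sum>v<N. \<Sum>p\<in>idx n. \<Sum>q\<in>idx n. of_rat (c p q) * h p q v)"
      by (simp add: u_def h_def sum_distrib_right)
    also have "\<dots> = (\<Sum>p\<in>idx n. \<Sum>v<N. \<Sum>q\<in>idx n. of_rat (c p q) * h p q v)"
      by (rule sum.swap)
    also have "\<dots> = (\<Sum>p\<in>idx n. \<Sum>q\<in>idx n. \<Sum>v<N. of_rat (c p q) * h p q v)"
      by (rule sum.cong[OF refl], rule sum.swap)
    also have "\<dots> = (\<Sum>p\<in>idx n. \<Sum>q\<in>idx n. of_rat (c p q) * ((\<Sum>v<N. h p q v) - M (snd p) (snd q) N))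
        + (\<Sum>p\<in>idx n. \<Sum>q\<in>idx n. of_rat (c p q) * M (snd p) (snd q) N)"
      by (simp add: right_diff_distrib sum_subtractf sum_distrib_left)
    also have "(\<Sum>p\<in>idx n. \<Sum>q\<in>idx n. of_rat (c p q) * M (snd p) (snd q) N)
        = of_rat d * (M 2 3 N - M 3 2 N)"
      unfolding d_def by (rule antisymmetric_form[OF anti res, where M = "\<lambda>s t. M s t N"])
    finally show ?thesis .
  qed
  have M: "(\<lambda>N. M s t N) \<longlonglongrightarrow> mzv [s, t]" if "s \<ge> 2" "t \<ge> 2" for s t
    using mzv_pair[OF that] by (simp add: M_def sums_def)
  have outer: "(\<lambda>v. \<Sum>p\<in>idx n. u v p * ztail (snd p) (w v p)) sums
      (Z + of_rat d * (mzv [2, 3] - mzv [3, 2]))"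
    unfolding sums_def part Z_def
    by (intro tendsto_add tendsto_sum tendsto_mult tendsto_diff tendsto_const M z) auto
  have "Z \<in> zspan" unfolding Z_def by (intro zspan_sum zspan_scale z)
  then obtain a' b' c' where Z: "Z = of_rat a' + of_rat b' * mzv [2] + of_rat c' * mzv [3]"
    by (auto simp: zspan_def mzv_singleton)
  obtain C where C: "C \<ge> 0"
    "\<And>k1 k2. k1 \<ge> 1 \<Longrightarrow> k2 \<ge> 1 \<Longrightarrow> \<bar>g k1 k2\<bar> \<le> C * (1 / real k1 ^ 2 * (1 / real k2 ^ 2))"
    using bivariate_bound[OF assms(2,3), of r1 r2] unfolding g_def by metis
  let ?f = "\<lambda>(v, d). g (Suc v + d) (Suc v)"
  have bound: "\<bar>?f (v, d)\<bar> \<le> C * (1 / real (Suc v) ^ 2 * (1 / real (Suc d) ^ 2))" for v d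
  proof -
    have "\<bar>?f (v, d)\<bar> \<le> C * (1 / real (Suc v + d) ^ 2 * (1 / real (Suc v) ^ 2))"
      using C(2)[of "Suc v + d" "Suc v"] by simp
    \<comment> \<open>Replacing \<open>k1 = v + 1 + d\<close> by the smaller \<open>d + 1\<close>
      separates the variables.\<close>
    also have "\<dots> \<le> C * (1 / real (Suc d) ^ 2 * (1 / real (Suc v) ^ 2))"
      using C(1) by (intro mult_left_mono mult_right_mono divide_left_mono power_mono) auto
    finally show ?thesis by (simp only: mult.commute)
  qed
  have inner': "(\<lambda>d. ?f (v, d)) sums (\<Sum>p\<in>idx n. u v p * ztail (snd p) (w v p))" for v
    using inner[of v] by (simp del: of_nat_Suc)
  have "(?f has_sum (Z + of_rat d * (mzv [2, 3] - mzv [3, 2]))) UNIV"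
    using has_sum_iterated(2)[of ?f C, OF bound inner'] outer by (simp add: sums_iff)
  \<comment> \<open>Here \<open>d = k1 - k2\<close> may be 0, as the series includes the diagonal;
    in \<open>mzv_pair\<close> the gap is \<open>d + 1\<close>.\<close>
  also have "?this \<longleftrightarrow> ((\<lambda>(k1, k2). g k1 k2) has_sum (Z + of_rat d * (mzv [2, 3] - mzv [3, 2])))
      {(k1, k2). k1 \<ge> k2 \<and> k2 \<ge> 1}"
    by (rule has_sum_reindex_bij_witness[where i = "\<lambda>(k1, k2). (k2 - 1, k1 - k2)"
          and j = "\<lambda>(v, d). (Suc v + d, Suc v)"]) auto
  finally show ?thesis unfolding g_def Z by blast
qed

end
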